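(* Let $n\ge 2$, let $w,w'\in\mathcal T_n$ be two Coxeter elements, let $\mathbb K$ be a field of characteristic $0$, and let $f:\mathcal I_n\to\mathbb K$ be a statistic that is a $\mathbb K$-linear combination of the indicator functions $\chi_1,\dots,\chi_n$. Then, for $c\in\mathbb K$, $f$ is $c$-mesic under the action of $w$ if and only if $f$ is $c$-mesic under the action of $w'$.
   Context: $[n]=\{1,\dots,n\}$. $\mathcal I_n$ is the set of independent sets of the path graph on $[n]$, i.e. subsets $S\subseteq[n]$ containing no two consecutive integers. For $i\in[n]$ the toggle $\tau_i:\mathcal I_n\to\mathcal I_n$ is defined by: $\tau_i(S)=S\setminus\{i\}$ if $i\in S$; $\tau_i(S)=S\cup\{i\}$ if $i\notin S$ and $S\cup\{i\}\in\mathcal I_n$; and $\tau_i(S)=S$ otherwise. The toggle group $\mathcal T_n$ is the subgroup of the symmetric group on the set $\mathcal I_n$ generated by $\tau_1,\dots,\tau_n$. A Coxeter element of $\mathcal T_n$ is a product of $\tau_1,\dots,\tau_n$, each used exactly once, in some order. $\chi_j(S)=1$ if $j\in S$ and $0$ otherwise. A function $f:\mathcal I_n\to\mathbb K$ is $c$-mesic under the action of $w$ if $\frac1{\#\mathcal O}\sum_{S\in\mathcal O}f(S)=c$ for every $w$-orbit $\mathcal O\subseteq\mathcal I_n$. *)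

theory Defs
  imports
    "HOL-Algebra.Bij"
    "HOL-Algebra.Elementary_Groups"
    "HOL-Combinatorics.Orbits"
begin

definition indep_sets :: "nat \<Rightarrow> nat set set" where
  "indep_sets n = {S. S \<subseteq> {1..n} \<and> (\<forall>i. \<not> (i \<in> S \<and> Suc i \<in> S))}"

(* Restricted to indep_sets n so that a toggle is an element of
   BijGroup (indep_sets n), whose elements are extensional functions. *)
definition toggle :: "nat \<Rightarrow> nat \<Rightarrow> nat set \<Rightarrow> nat set" where
  "toggle n i = (\<lambda>S\<in>indep_sets n.
     if i \<in> S then S - {i}
     else if S \<union> {i} \<in> indep_sets n then S \<union> {i}
     else S)"

definition toggle_group :: "nat \<Rightarrow> (nat set \<Rightarrow> nat set) monoid" where
  "toggle_group n = subgroup_generated (BijGroup (indep_sets n)) (toggle n ` {1..n})"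

definition coxeter_elements :: "nat \<Rightarrow> (nat set \<Rightarrow> nat set) set" where
  "coxeter_elements n =
     {foldr (\<lambda>g h. g \<otimes>\<^bsub>toggle_group n\<^esub> h) (map (toggle n) js) \<one>\<^bsub>toggle_group n\<^esub> | js.
        distinct js \<and> set js = {1..n}}"

definition chi :: "nat \<Rightarrow> nat set \<Rightarrow> 'k::field_char_0" where
  "chi j S = (if j \<in> S then 1 else 0)"

(* The library's orbit w x consists of the iterates of w at x with positive
   exponent; for a bijection w of a finite set X and x in X this is the orbit
   of x under the cyclic group generated by w. *)
definition mesic_on :: "'a set \<Rightarrow> ('a \<Rightarrow> 'a) \<Rightarrow> 'k::field_char_0 \<Rightarrow> ('a \<Rightarrow> 'k) \<Rightarrow> bool" where
  "mesic_on X w c f \<longleftrightarrow>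
     (\<forall>Orb \<in> orbit w ` X. 1 / of_nat (card Orb) * (\<Sum>S\<in>Orb. f S) = c)"

lemma finite_indep_sets: "finite (indep_sets n)"
  by (rule finite_subset[of _ "Pow {1..n}"]) (auto simp: indep_sets_def)

lemma toggle_in_indep_sets: "S \<in> indep_sets n \<Longrightarrow> toggle n i S \<in> indep_sets n"
  by (auto simp: toggle_def indep_sets_def)

lemma toggle_toggle: "S \<in> indep_sets n \<Longrightarrow> toggle n i (toggle n i S) = S"
  using toggle_in_indep_sets[of S n i]
  by (auto simp: toggle_def insert_absorb)

lemma toggle_in_BijGroup: "toggle n i \<in> carrier (BijGroup (indep_sets n))"
proof -
  have "bij_betw (toggle n i) (indep_sets n) (indep_sets n)"
    by (rule bij_betw_byWitness[where f' = "toggle n i"])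
      (auto simp: toggle_toggle toggle_in_indep_sets)
  then show ?thesis
    by (simp add: BijGroup_def Bij_def toggle_def)
qed

lemma group_toggle_group: "group (toggle_group n)"
  unfolding toggle_group_def by (rule group.group_subgroup_generated[OF group_BijGroup])

lemma toggle_in_toggle_group: "i \<in> {1..n} \<Longrightarrow> toggle n i \<in> carrier (toggle_group n)"
  unfolding toggle_group_def carrier_subgroup_generated
  by (rule generate.incl) (use toggle_in_BijGroup in auto)

lemma coxeter_elements_subset: "coxeter_elements n \<subseteq> carrier (toggle_group n)"
proof -
  interpret group "toggle_group n" by (rule group_toggle_group)
  have "foldr (\<lambda>g h. g \<otimes>\<^bsub>toggle_group n\<^esub> h) (map (toggle n) js) \<one>\<^bsub>toggle_group n\<^esub>
      \<in> carrier (toggle_group n)" if "set js \<subseteq> {1..n}" for js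
    using that by (induction js) (auto intro!: m_closed toggle_in_toggle_group)
  then show ?thesis
    unfolding coxeter_elements_def by auto
qed

lemma toggle_group_bij_betw:
  assumes "w \<in> carrier (toggle_group n)"
  shows "bij_betw w (indep_sets n) (indep_sets n)"
  using assms group.carrier_subgroup_generated_subset[OF group_BijGroup]
  by (force simp: toggle_group_def BijGroup_def Bij_def)

end

(* Two words in the toggles give the same average of every chi j on corresponding orbits if they
   differ by moving the first letter i to the end: with w = tau_i u and w' = u tau_i, the map u
   carries each w-orbit to a w'-orbit, it leaves chi i unchanged since u does not involve tau_i,
   and for j \<noteq> i it has the same effect on chi j as w, which permutes the orbit. As the path is a
   tree, any two words using each toggle once are related by such rotations and by commutations of
   toggles at non-adjacent vertices. *)
theory Submission
  imports Defs
begin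

section \<open>Rotations and commutations of words\<close>

text \<open>Letters are vertices of the path. \<open>rot\<close> turns a product of toggles into a
  conjugate of it, and \<open>comm\<close> swaps letters that are not joined in the path, so that
  their toggles commute.\<close>

inductive word_step :: "nat list \<Rightarrow> nat list \<Rightarrow> bool" where
  rot: "word_step (i # xs) (xs @ [i])"
| comm: "i \<noteq> Suc j \<Longrightarrow> j \<noteq> Suc i \<Longrightarrow> word_step (xs @ i # j # ys) (xs @ j # i # ys)"

lemma word_step_set: "word_step xs ys \<Longrightarrow> set ys = set xs"
  by (induction rule: word_step.induct) auto

lemma word_step_distinct: "word_step xs ys \<Longrightarrow> distinct xs \<Longrightarrow> distinct ys"
  by (induction rule: word_step.induct) auto

lemma word_steps_set: "word_step\<^sup>*\<^sup>* xs ys \<Longrightarrow> set ys = set xs"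
  by (induction rule: rtranclp_induct) (auto simp: word_step_set)

lemma word_steps_distinct: "word_step\<^sup>*\<^sup>* xs ys \<Longrightarrow> distinct xs \<Longrightarrow> distinct ys"
  by (induction rule: rtranclp_induct) (auto simp: word_step_distinct)

text \<open>In the case of a commutation of \<open>i\<close> and \<open>j\<close> with the new letter between them, one of
  \<open>i\<close>, \<open>j\<close> differs from \<open>n\<close>, so that the new letter can first be moved past it.\<close>
lemma word_step_insert:
  assumes "word_step (u @ v) ys" "set (u @ v) \<subseteq> {..n}" "distinct (u @ v)"
  shows "\<exists>u' v'. word_step\<^sup>*\<^sup>* (u @ Suc n # v) (u' @ Suc n # v') \<and> u' @ v' = ys"
  using assms(1)
proof cases
  case (rot i xs)
  show ?thesis
  proof (cases u)
    case Nil
    \<comment> \<open>With \<open>Suc n\<close> in front, two rotations are needed: first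
      \<open>Suc n\<close> goes to the end, then \<open>i\<close> behind it.\<close>
    then have "word_step (u @ Suc n # v) (i # xs @ [Suc n])"
      using rot word_step.rot[of "Suc n" "i # xs"] by simp
    moreover have "word_step (i # xs @ [Suc n]) (xs @ Suc n # [i])"
      using word_step.rot[of i "xs @ [Suc n]"] by simp
    ultimately have "word_step\<^sup>*\<^sup>* (u @ Suc n # v) (xs @ Suc n # [i])"
      by (meson converse_rtranclp_into_rtranclp r_into_rtranclp)
    then show ?thesis using rot by blast
  next
    case (Cons a u')
    then have "word_step (u @ Suc n # v) (u' @ Suc n # (v @ [i]))"
      using rot word_step.rot[of i "u' @ Suc n # v"] by simp
    then show ?thesis using rot Cons by (metis append.assoc append_Cons list.inject r_into_rtranclp)
  qed
next
  case (comm i j xs zs)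
  have nb: "i \<le> n" "j \<le> n" "i \<noteq> j"
    using assms(2,3) unfolding comm(1) by auto
  \<comment> \<open>The new letter stands before, between or after the two swapped letters.\<close>
  consider r where "u @ r = xs" "v = r @ i # j # zs" | "u = xs @ [i]" "v = j # zs"
    | r where "u = xs @ i # j # r" "r @ v = zs"
  proof -
    have "(\<exists>r. u @ r = xs \<and> v = r @ i # j # zs) \<or> (u = xs @ [i] \<and> v = j # zs)
       \<or> (\<exists>r. u = xs @ i # j # r \<and> r @ v = zs)"
      using comm(1) by (auto simp: append_eq_append_conv2 append_eq_Cons_conv Cons_eq_append_conv)
    then show thesis using that by blast
  qed
  then show ?thesis
  proof cases
    case 1
    then have "word_step (u @ Suc n # v) (u @ Suc n # (r @ j # i # zs))"
      using word_step.comm[of i j "u @ Suc n # r" zs] comm by simp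
    then show ?thesis using comm(2) 1 by (metis append.assoc r_into_rtranclp)
  next
    case 3
    then have "word_step (u @ Suc n # v) ((xs @ j # i # r) @ Suc n # v)"
      using word_step.comm[of i j xs "r @ Suc n # v"] comm by simp
    then show ?thesis using comm(2) 3 by (metis append.assoc append_Cons r_into_rtranclp)
  next
    case 2
    show ?thesis
    proof (cases "i = n")
      case True
      have "word_step (u @ Suc n # v) (xs @ i # j # Suc n # zs)"
        using word_step.comm[of "Suc n" j "xs @ [i]" zs] 2 nb True by simp
      moreover have "word_step (xs @ i # j # Suc n # zs) ((xs @ [j, i]) @ Suc n # zs)"
        using word_step.comm[of i j xs "Suc n # zs"] comm by simp
      ultimately have "word_step\<^sup>*\<^sup>* (u @ Suc n # v) ((xs @ [j, i]) @ Suc n # zs)"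
        by (meson converse_rtranclp_into_rtranclp r_into_rtranclp)
      moreover have "(xs @ [j, i]) @ zs = ys" using comm by simp
      ultimately show ?thesis by blast
    next
      case False
      have "word_step (u @ Suc n # v) (xs @ Suc n # i # j # zs)"
        using word_step.comm[of i "Suc n" xs "j # zs"] 2 nb False by simp
      moreover have "word_step (xs @ Suc n # i # j # zs) (xs @ Suc n # (j # i # zs))"
        using word_step.comm[of i j "xs @ [Suc n]" zs] comm by simp
      ultimately have "word_step\<^sup>*\<^sup>* (u @ Suc n # v) (xs @ Suc n # (j # i # zs))"
        by (meson converse_rtranclp_into_rtranclp r_into_rtranclp)
      then show ?thesis using comm(2) by blast
    qed
  qed
qed

text \<open>Lifts a whole chain of steps to words with one more letter. The final position of
  \<open>Suc n\<close> is not controlled; \<open>word_steps_upt\<close> corrects it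
  afterwards.\<close>

lemma word_steps_insert:
  assumes "word_step\<^sup>*\<^sup>* (u @ v) ys" "set (u @ v) \<subseteq> {..n}" "distinct (u @ v)"
  shows "\<exists>u' v'. word_step\<^sup>*\<^sup>* (u @ Suc n # v) (u' @ Suc n # v') \<and> u' @ v' = ys"
  using assms(1)
proof (induction rule: rtranclp_induct)
  case base
  then show ?case by blast
next
  case (step ys zs)
  then obtain u' v' where u': "word_step\<^sup>*\<^sup>* (u @ Suc n # v) (u' @ Suc n # v')" "u' @ v' = ys"
    by blast
  have "set (u' @ v') \<subseteq> {..n}" "distinct (u' @ v')"
    using word_steps_set[OF step(1)] word_steps_distinct[OF step(1)] assms(2,3) u'(2) by auto
  with word_step_insert[of u' v' zs n] step(2) u'(2)
  obtain u'' v'' where "word_step\<^sup>*\<^sup>* (u' @ Suc n # v') (u'' @ Suc n # v'')" "u'' @ v'' = zs"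
    by blast
  then show ?case using u'(1) rtranclp_trans by fast
qed

text \<open>The letter \<open>m\<close> commutes with every letter of \<open>u\<close> and passes
  them one at a time, beginning with the last.\<close>

lemma word_steps_to_front:
  "\<forall>i\<in>set u. i \<noteq> Suc m \<and> m \<noteq> Suc i \<Longrightarrow> word_step\<^sup>*\<^sup>* (u @ m # v) (m # u @ v)"
proof (induction u arbitrary: v rule: rev_induct)
  case (snoc i u)
  then have "word_step ((u @ [i]) @ m # v) (u @ m # i # v)"
    using word_step.comm[of i m u v] by simp
  moreover have "word_step\<^sup>*\<^sup>* (u @ m # i # v) (m # u @ i # v)"
    using snoc by simp
  ultimately show ?case by (simp add: converse_rtranclp_into_rtranclp)
qed simp

text \<open>Induction removes the leaf \<open>Suc n\<close> of the path, sorts the remaining letters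
  and lifts these steps. If \<open>Suc n\<close> then is not at the end, it can be moved to the
  front and rotated to the end.\<close>

lemma word_steps_upt:
  "distinct xs \<Longrightarrow> set xs = {1..n} \<Longrightarrow> word_step\<^sup>*\<^sup>* xs [1..<Suc n]"
proof (induction n arbitrary: xs)
  case (Suc n)
  have "Suc n \<in> set xs" using Suc.prems by simp
  then obtain u v where xs: "xs = u @ Suc n # v" by (meson split_list)
  have d: "distinct (u @ v)" using Suc.prems xs by auto
  have "set (u @ v) = set xs - {Suc n}" using Suc.prems(1) xs by auto
  also have "\<dots> = {1..n}" unfolding Suc.prems(2) by auto
  finally have s: "set (u @ v) = {1..n}" .
  have "set (u @ v) \<subseteq> {..n}" using s by auto
  with word_steps_insert[OF Suc.IH[OF d s] _ d] obtain u' v' where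
    u': "word_step\<^sup>*\<^sup>* xs (u' @ Suc n # v')" "u' @ v' = [1..<Suc n]"
    unfolding xs by blast
  show ?case
  proof (cases "v' = []")
    case True
    then show ?thesis using u' by simp
  next
    case False
    have n: "n \<in> set v'" "distinct (u' @ v')" "set u' \<subseteq> {1..n}"
    proof -
      show "distinct (u' @ v')" using u'(2) by (metis distinct_upt)
      show "set u' \<subseteq> {1..n}" using arg_cong[OF u'(2), of set] by auto
      have "last v' = last [1..<Suc n]" using u'(2) False by (metis last_appendR)
      moreover have "n \<ge> 1" using u'(2) False by (cases n) auto
      ultimately have "last v' = n" by simp
      then show "n \<in> set v'" using False last_in_set by metis
    qed
    \<comment> \<open>The only neighbour of \<open>Suc n\<close> among the letters is
      \<open>n\<close>, which lies in \<open>v'\<close> and hence, by distinctness, not in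
      \<open>u'\<close>.\<close>
    then have "\<forall>i\<in>set u'. i \<noteq> Suc (Suc n) \<and> Suc n \<noteq> Suc i" by auto
    then have "word_step\<^sup>*\<^sup>* (u' @ Suc n # v') (Suc n # u' @ v')"
      by (rule word_steps_to_front)
    moreover have "word_step (Suc n # u' @ v') [1..<Suc (Suc n)]"
      using word_step.rot[of "Suc n" "u' @ v'"] u'(2) by simp
    ultimately show ?thesis
      using u'(1) by (meson rtranclp.rtrancl_into_rtrancl rtranclp_trans)
  qed
qed simp

section \<open>Orbits\<close>

text \<open>By induction, \<open>h\<close> sends each iterate of \<open>f\<close> at
  \<open>x\<close> to the same iterate of \<open>g\<close> at \<open>h x\<close>.\<close>

lemma orbit_semiconj:
  assumes "\<And>y. h (f y) = g (h y)"
  shows "orbit g (h x) = h ` orbit f x"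
proof (intro equalityI subsetI)
  fix y assume "y \<in> orbit g (h x)"
  then show "y \<in> h ` orbit f x"
    by induction (auto simp flip: assms intro: orbit.intros)
next
  fix y assume "y \<in> h ` orbit f x"
  then obtain z where "z \<in> orbit f x" "y = h z" by blast
  from this(1) have "h z \<in> orbit g (h x)"
    by induction (auto simp: assms intro: orbit.intros)
  then show "y \<in> orbit g (h x)" using \<open>y = h z\<close> by simp
qed

lemma orbit_subset_invariant:
  assumes "f \<in> X \<rightarrow> X" "x \<in> X"
  shows "orbit f x \<subseteq> X"
proof
  fix y assume "y \<in> orbit f x"
  then show "y \<in> X" by induction (use assms in auto)
qed

lemma orbit_eq_on_invariant:
  assumes "f \<in> X \<rightarrow> X" "x \<in> X" "\<And>y. y \<in> X \<Longrightarrow> f y = g y"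
  shows "orbit f x = orbit g x"
proof -
  \<comment> \<open>Stated for arbitrary functions, so that it can be applied again with the roles
    exchanged.\<close>
  have sub: "orbit f x \<subseteq> orbit g x"
    if f: "f \<in> X \<rightarrow> X" and eq: "\<And>y. y \<in> X \<Longrightarrow> f y = g y" for f g
  proof
    fix y assume "y \<in> orbit f x"
    then show "y \<in> orbit g x"
    proof induction
      case base
      show ?case unfolding eq[OF assms(2)] by (rule orbit.base)
    next
      case (step y)
      have "y \<in> X" using orbit_subset_invariant[OF f assms(2)] step(1) by blast
      then show ?case unfolding eq[OF \<open>y \<in> X\<close>] using step by (intro orbit.step)
    qed
  qed
  have "g \<in> X \<rightarrow> X" using assms(1,3) by (simp add: Pi_iff)
  then show ?thesis using sub[of f g] sub[of g f] assms by auto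
qed

text \<open>Serves to compare group products with composites of toggles, and the two orders of
  commuting toggles, whose agreement is shown on \<open>indep_sets n\<close> only.\<close>

lemma mesic_on_cong:
  assumes "w \<in> X \<rightarrow> X" "\<And>y. y \<in> X \<Longrightarrow> w y = w' y"
  shows "mesic_on X w c f \<longleftrightarrow> mesic_on X w' c f"
proof -
  have "orbit w ` X = orbit w' ` X"
    using orbit_eq_on_invariant[OF assms(1) _ assms(2)] by (intro image_cong) auto
  then show ?thesis by (simp add: mesic_on_def)
qed

text \<open>The orbit is finite and \<open>w\<close> maps it injectively into itself, hence permutes
  it.\<close>

lemma sum_orbit_shift:
  assumes "finite X" "bij_betw w X X" "x \<in> X"
  shows "(\<Sum>y\<in>orbit w x. g (w y)) = (\<Sum>y\<in>orbit w x. g y)"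
proof -
  have sub: "orbit w x \<subseteq> X"
    using assms by (intro orbit_subset_invariant) (auto simp: bij_betw_def)
  have inj: "inj_on w (orbit w x)"
    using assms(2) sub by (meson bij_betw_def inj_on_subset)
  have "w ` orbit w x = orbit w x"
    using inj sub assms(1) by (intro endo_inj_surj) (auto intro: finite_subset orbit.step)
  then show ?thesis
    using sum.reindex[OF inj, of g] by simp
qed

section \<open>Toggle words\<close>

text \<open>The left neighbour is expressed through \<open>Suc k\<close>, which avoids subtraction
  on naturals.\<close>

lemma insert_in_indep_sets_iff:
  assumes "S \<in> indep_sets n"
  shows "insert i S \<in> indep_sets n \<longleftrightarrow> i \<in> {1..n} \<and> Suc i \<notin> S \<and> (\<forall>k\<in>S. i \<noteq> Suc k)"
  using assms by (auto simp: indep_sets_def)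

lemma mem_toggle_iff:
  assumes "S \<in> indep_sets n"
  shows "k \<in> toggle n i S \<longleftrightarrow> (if k = i then i \<notin> S \<and> insert i S \<in> indep_sets n else k \<in> S)"
  using assms by (auto simp: toggle_def)

text \<open>Whether \<open>i\<close> may be added depends only on its neighbours, and the toggle at
  \<open>j\<close> affects none of them.\<close>

lemma insert_toggle_in_indep_sets_iff:
  assumes "S \<in> indep_sets n" "i \<noteq> Suc j" "j \<noteq> Suc i"
  shows "insert i (toggle n j S) \<in> indep_sets n \<longleftrightarrow> insert i S \<in> indep_sets n"
  using assms(2,3)
  by (simp add: insert_in_indep_sets_iff toggle_in_indep_sets assms(1))
    (metis assms(1) mem_toggle_iff)

lemma toggle_comm:
  assumes "S \<in> indep_sets n" "i \<noteq> Suc j" "j \<noteq> Suc i"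
  shows "toggle n i (toggle n j S) = toggle n j (toggle n i S)"
proof (cases "i = j")
  case False
  show ?thesis
  proof (rule Set.set_eqI)
    show "k \<in> toggle n i (toggle n j S) \<longleftrightarrow> k \<in> toggle n j (toggle n i S)" for k
      using assms False
      by (simp add: mem_toggle_iff toggle_in_indep_sets insert_toggle_in_indep_sets_iff)
  qed
qed simp

lemma chi_toggle:
  "S \<in> indep_sets n \<Longrightarrow> j \<noteq> i \<Longrightarrow> chi j (toggle n i S) = chi j S"
  by (auto simp: chi_def toggle_def)

lemma foldr_toggle_in: "S \<in> indep_sets n \<Longrightarrow> foldr (toggle n) js S \<in> indep_sets n"
  by (induction js) (auto intro: toggle_in_indep_sets)

lemma bij_betw_foldr_toggle: "bij_betw (foldr (toggle n) js) (indep_sets n) (indep_sets n)"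
proof (induction js)
  case (Cons i js)
  have "bij_betw (toggle n i) (indep_sets n) (indep_sets n)"
    using toggle_in_BijGroup[of n i] by (simp add: BijGroup_def Bij_def)
  from bij_betw_trans[OF Cons this] show ?case by (simp add: o_def)
qed (simp add: bij_betw_def inj_on_def)

lemma chi_foldr_toggle:
  "S \<in> indep_sets n \<Longrightarrow> j \<notin> set js \<Longrightarrow> chi j (foldr (toggle n) js S) = chi j S"
  by (induction js) (auto simp: chi_toggle foldr_toggle_in)

lemma foldr_mult_toggle_group:
  assumes "S \<in> indep_sets n"
  shows "foldr (\<lambda>g h. g \<otimes>\<^bsub>toggle_group n\<^esub> h) (map (toggle n) js) \<one>\<^bsub>toggle_group n\<^esub> S
    = foldr (toggle n) js S"
proof -
  let ?B = "BijGroup (indep_sets n)"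
  define W where "W js = foldr (\<lambda>g h. g \<otimes>\<^bsub>?B\<^esub> h) (map (toggle n) js) \<one>\<^bsub>?B\<^esub>" for js
  interpret group ?B by (rule group_BijGroup)
  have mult: "(g \<otimes>\<^bsub>?B\<^esub> h) S = g (h S)" if "g \<in> carrier ?B" "h \<in> carrier ?B" for g h
    using that assms by (simp add: BijGroup_def compose_def)
  \<comment> \<open>Membership in the carrier is proved along, because \<open>mult\<close> evaluates
    products of carrier elements only.\<close>
  have "W js \<in> carrier ?B \<and> W js S = foldr (toggle n) js S"
  proof (induction js)
    case Nil
    have "\<one>\<^bsub>?B\<^esub> S = S" using assms by (simp add: BijGroup_def)
    then show ?case by (simp add: W_def)
  next
    case (Cons i js)
    have "W (i # js) = toggle n i \<otimes>\<^bsub>?B\<^esub> W js" by (simp add: W_def)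
    then show ?case using Cons mult toggle_in_BijGroup by auto
  qed
  then show ?thesis by (simp add: W_def toggle_group_def)
qed

section \<open>Invariance of mesy under rotations and commutations\<close>

lemma mesic_on_rotate:
  fixes f :: "nat set \<Rightarrow> 'k::field_char_0"
  assumes "i \<notin> set js" and f: "\<And>S. S \<in> indep_sets n \<Longrightarrow> f S = (\<Sum>j\<in>{1..n}. a j * chi j S)"
  shows "mesic_on (indep_sets n) (foldr (toggle n) (i # js)) c f
    \<longleftrightarrow> mesic_on (indep_sets n) (foldr (toggle n) (js @ [i])) c f"
proof -
  let ?X = "indep_sets n" and ?u = "foldr (toggle n) js"
  let ?w = "foldr (toggle n) (i # js)" and ?w' = "foldr (toggle n) (js @ [i])"
  have u: "bij_betw ?u ?X ?X" and w: "bij_betw ?w ?X ?X"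
    by (rule bij_betw_foldr_toggle)+
  \<comment> \<open>Both \<open>?u\<close> after \<open>?w\<close> and \<open>?w'\<close> after
    \<open>?u\<close> are the composite of the word \<open>js @ i # js\<close>, so the intertwining
    holds at every set.\<close>
  have orb: "orbit ?w' (?u x) = ?u ` orbit ?w x" for x
    by (rule orbit_semiconj) simp
  have sub: "orbit ?w x \<subseteq> ?X" if "x \<in> ?X" for x
    using that w by (intro orbit_subset_invariant) (auto simp: bij_betw_def)
  have inj: "inj_on ?u (orbit ?w x)" if "x \<in> ?X" for x
    using u sub[OF that] by (meson bij_betw_def inj_on_subset)
  have chi_eq: "(\<Sum>S\<in>orbit ?w x. chi j (?u S)) = (\<Sum>S\<in>orbit ?w x. chi j S :: 'k)"
    if x: "x \<in> ?X" for x j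
  proof (cases "j = i")
    case True
    then show ?thesis
      using sub[OF x] assms(1) by (intro sum.cong) (auto simp: chi_foldr_toggle)
  next
    case False
    \<comment> \<open>\<open>?w\<close> is \<open>?u\<close> followed by the toggle at
      \<open>i\<close>, which leaves \<open>chi j\<close> unchanged.\<close>
    have "(\<Sum>S\<in>orbit ?w x. chi j (?u S)) = (\<Sum>S\<in>orbit ?w x. chi j (?w S) :: 'k)"
      using sub[OF x] False by (intro sum.cong) (auto simp: chi_toggle foldr_toggle_in)
    also have "\<dots> = (\<Sum>S\<in>orbit ?w x. chi j S)"
      by (rule sum_orbit_shift[OF finite_indep_sets w x])
    finally show ?thesis .
  qed
  \<comment> \<open>The map \<open>h\<close> is left general to cover both \<open>?u\<close> and the
    identity.\<close>
  have lin: "(\<Sum>S\<in>orbit ?w x. f (h S)) = (\<Sum>j\<in>{1..n}. a j * (\<Sum>S\<in>orbit ?w x. chi j (h S)))"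
    if "x \<in> ?X" "h \<in> ?X \<rightarrow> ?X" for x h
  proof -
    have "(\<Sum>S\<in>orbit ?w x. f (h S)) = (\<Sum>S\<in>orbit ?w x. \<Sum>j\<in>{1..n}. a j * chi j (h S))"
      using sub[OF that(1)] that(2) by (intro sum.cong f) auto
    also have "\<dots> = (\<Sum>j\<in>{1..n}. \<Sum>S\<in>orbit ?w x. a j * chi j (h S))"
      by (rule sum.swap)
    finally show ?thesis
      by (simp only: sum_distrib_left)
  qed
  have avg: "card (orbit ?w' (?u x)) = card (orbit ?w x)"
    "sum f (orbit ?w' (?u x)) = sum f (orbit ?w x)" if x: "x \<in> ?X" for x
  proof -
    show "card (orbit ?w' (?u x)) = card (orbit ?w x)"
      unfolding orb by (rule card_image[OF inj[OF x]])
    have "sum f (orbit ?w' (?u x)) = (\<Sum>S\<in>orbit ?w x. f (?u S))"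
      unfolding orb sum.reindex[OF inj[OF x]] by (simp only: o_def)
    also have "\<dots> = (\<Sum>S\<in>orbit ?w x. f S)"
      using lin[OF x, of ?u] lin[OF x, of "\<lambda>S. S"] chi_eq[OF x] by (simp add: foldr_toggle_in)
    finally show "sum f (orbit ?w' (?u x)) = sum f (orbit ?w x)" .
  qed
  \<comment> \<open>As \<open>?u\<close> is onto \<open>?X\<close>, every orbit of
    \<open>?w'\<close> in \<open>?X\<close> starts at some \<open>?u x\<close>.\<close>
  have "orbit ?w' ` ?X = (\<lambda>x. orbit ?w' (?u x)) ` ?X"
    using bij_betw_imp_surj_on[OF u] by (metis image_image)
  then show ?thesis
    using avg by (simp add: mesic_on_def del: foldr.simps foldr_append)
qed

text \<open>Distinctness persists along the chain and ensures that a rotated letter does not recur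
  in its word, as \<open>mesic_on_rotate\<close> demands.\<close>

lemma mesic_on_word_steps:
  fixes f :: "nat set \<Rightarrow> 'k::field_char_0"
  assumes "word_step\<^sup>*\<^sup>* js ks" "distinct js"
    and f: "\<And>S. S \<in> indep_sets n \<Longrightarrow> f S = (\<Sum>j\<in>{1..n}. a j * chi j S)"
  shows "mesic_on (indep_sets n) (foldr (toggle n) js) c f
    \<longleftrightarrow> mesic_on (indep_sets n) (foldr (toggle n) ks) c f"
  using assms(1)
proof (induction rule: rtranclp_induct)
  case (step ks ls)
  have d: "distinct ks" using word_steps_distinct[OF step(1) assms(2)] .
  from step(2) have "mesic_on (indep_sets n) (foldr (toggle n) ks) c f
    \<longleftrightarrow> mesic_on (indep_sets n) (foldr (toggle n) ls) c f"
  proof cases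
    case (rot i xs)
    then show ?thesis using mesic_on_rotate[OF _ f, of i xs] d by simp
  next
    case (comm i j xs ys)
    then show ?thesis
      by (intro mesic_on_cong) (simp_all add: foldr_toggle_in toggle_in_indep_sets toggle_comm[of _ n i j])
  qed
  with step.IH show ?case by simp
qed simp

theorem theorem2p30:
  fixes n :: nat
    and w w' :: "nat set \<Rightarrow> nat set"
    and f :: "nat set \<Rightarrow> 'k::field_char_0"
    and c :: 'k
  assumes "n \<ge> 2"
    and "w \<in> coxeter_elements n"
    and "w' \<in> coxeter_elements n"
    and "\<exists>a :: nat \<Rightarrow> 'k. \<forall>S \<in> indep_sets n. f S = (\<Sum>j\<in>{1..n}. a j * chi j S)"
  shows "mesic_on (indep_sets n) w c f \<longleftrightarrow> mesic_on (indep_sets n) w' c f"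
proof -
  obtain a where f: "\<And>S. S \<in> indep_sets n \<Longrightarrow> f S = (\<Sum>j\<in>{1..n}. a j * chi j S)"
    using assms(4) by blast
  \<comment> \<open>Every Coxeter element is compared with the one fixed word
    \<open>1, ..., n\<close>.\<close>
  have "mesic_on (indep_sets n) v c f
    \<longleftrightarrow> mesic_on (indep_sets n) (foldr (toggle n) [1..<Suc n]) c f"
    if "v \<in> coxeter_elements n" for v
  proof -
    from that obtain js where js: "distinct js" "set js = {1..n}"
      and v: "v = foldr (\<lambda>g h. g \<otimes>\<^bsub>toggle_group n\<^esub> h) (map (toggle n) js) \<one>\<^bsub>toggle_group n\<^esub>"
      unfolding coxeter_elements_def by blast
    have "mesic_on (indep_sets n) v c f \<longleftrightarrow> mesic_on (indep_sets n) (foldr (toggle n) js) c f"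
      unfolding v
      by (intro mesic_on_cong) (simp_all add: foldr_mult_toggle_group foldr_toggle_in)
    also have "\<dots> \<longleftrightarrow> mesic_on (indep_sets n) (foldr (toggle n) [1..<Suc n]) c f"
      using mesic_on_word_steps[OF word_steps_upt[OF js] js(1) f] .
    finally show ?thesis .
  qed
  from this[OF assms(2)] this[OF assms(3)] show ?thesis by simp
qed

end
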